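(* For every prime number $p\ge 2$ there exists a connected Q2R network with exactly $2p$ vertices that has at least one limit cycle of length $p$.
   Context: A (generalized) Q2R network is given by a finite simple undirected bipartite graph $G=(V,E)$ in which every vertex has even degree, together with a bipartition $V=A\sqcup B$ (every edge joins a vertex of $A$ to a vertex of $B$). It is connected if $G$ is connected. Configurations are maps $x\in\{-1,1\}^V$. The local rule at a vertex $i$ is $$f_i(x)=\begin{cases}-x_i & \text{if } \sum_{j\in N(i)}x_j=0,\\ x_i & \text{otherwise,}\end{cases}$$ where $N(i)$ is the set of neighbors of $i$. One time step of the network is the map $F:\{-1,1\}^V\to\{-1,1\}^V$ that first replaces simultaneously the states of all vertices $i\in A$ by $f_i$ evaluated on the current configuration, and then replaces simultaneously the states of all vertices $i\in B$ by $f_i$ evaluated on the resulting configuration. The network has a limit cycle of length $T$ if there is a configuration $x$ with $F^T(x)=x$ and $F^s(x)\neq x$ for all $1\le s<T$. *)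

theory Defs
  imports
    "Graph_Theory.Digraph_Component"
    "HOL-Library.FuncSet"
    "HOL-Computational_Algebra.Primes"
begin

text \<open>
  A finite simple undirected graph is a \<open>pair_graph\<close>: a finite symmetric irreflexive relation
  on a finite vertex set, each undirected edge being represented by its two orientations.
\<close>

definition neighbors :: "'a pair_pre_digraph \<Rightarrow> 'a \<Rightarrow> 'a set" where
  "neighbors G i = {j. (i, j) \<in> parcs G}"

locale q2r_network = pair_graph G for G :: "'a pair_pre_digraph" +
  fixes A B :: "'a set"
  assumes verts_eq: "pverts G = A \<union> B"
    and parts_disjoint: "A \<inter> B = {}"
    and edges_across: "(i, j) \<in> parcs G \<Longrightarrow> (i \<in> A \<and> j \<in> B) \<or> (i \<in> B \<and> j \<in> A)"
    and even_degree: "i \<in> pverts G \<Longrightarrow> even (card (neighbors G i))"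

text \<open>
  Configurations are extensional functions (\<open>undefined\<close> outside the vertex set), so that
  equality of functions is equality of configurations.
\<close>

definition configurations :: "'a pair_pre_digraph \<Rightarrow> ('a \<Rightarrow> int) set" where
  "configurations G = pverts G \<rightarrow>\<^sub>E {-1, 1}"

definition local_rule :: "'a pair_pre_digraph \<Rightarrow> 'a \<Rightarrow> ('a \<Rightarrow> int) \<Rightarrow> int" where
  "local_rule G i x = (if (\<Sum>j\<in>neighbors G i. x j) = 0 then - x i else x i)"

definition update_on :: "'a pair_pre_digraph \<Rightarrow> 'a set \<Rightarrow> ('a \<Rightarrow> int) \<Rightarrow> 'a \<Rightarrow> int" where
  "update_on G S x = (\<lambda>i. if i \<in> S then local_rule G i x else x i)"

definition q2r_step :: "'a pair_pre_digraph \<Rightarrow> 'a set \<Rightarrow> 'a set \<Rightarrow> ('a \<Rightarrow> int) \<Rightarrow> 'a \<Rightarrow> int" where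
  "q2r_step G A B x = update_on G B (update_on G A x)"

definition has_limit_cycle :: "'a pair_pre_digraph \<Rightarrow> 'a set \<Rightarrow> 'a set \<Rightarrow> nat \<Rightarrow> bool" where
  "has_limit_cycle G A B T \<longleftrightarrow> T \<ge> 1 \<and>
     (\<exists>x\<in>configurations G. (q2r_step G A B ^^ T) x = x \<and>
        (\<forall>s. 1 \<le> s \<and> s < T \<longrightarrow> (q2r_step G A B ^^ s) x \<noteq> x))"

lemma update_on_configurations:
  assumes "x \<in> configurations G" "S \<subseteq> pverts G"
  shows "update_on G S x \<in> configurations G"
  using assms
  by (fastforce simp: configurations_def update_on_def local_rule_def PiE_iff extensional_def)

lemma (in q2r_network) q2r_step_configurations:
  assumes "x \<in> configurations G"
  shows "q2r_step G A B x \<in> configurations G"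
  using assms verts_eq by (simp add: q2r_step_def update_on_configurations)

end

theory Submission
  imports Defs
begin

text \<open>
  On the cycle \<open>C\<^sub>2\<^sub>p\<close> the rule is linear over \<open>GF(2)\<close>: a vertex flips iff its two neighbours differ.
  Equivalently, updating a vertex swaps the two domain-wall indicators on its incident edges, so
  walls travel around the cycle at constant speed, one family clockwise and the other
  anticlockwise, and return to their places after \<open>p\<close> steps. Starting from a single \<open>-1\<close> at vertex
  \<open>0\<close>, the configuration at time \<open>t\<close> is \<open>-1\<close> exactly at \<open>0\<close> and at the vertices that belong to one
  but not both of the arcs of length \<open>2t - 1\<close> emanating from \<open>0\<close> in the two directions.
  At time \<open>p\<close> both arcs cover all other vertices and cancel, whereas at times \<open>0 < s < p\<close>
  vertex \<open>1\<close> lies on only one arc.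
\<close>

definition cycle_graph :: "nat \<Rightarrow> nat pair_pre_digraph" where
  "cycle_graph n = \<lparr>pverts = {..<n},
     parcs = {(i, j). i < n \<and> j < n \<and>
       (j = Suc i \<or> i = Suc j \<or> i = 0 \<and> Suc j = n \<or> j = 0 \<and> Suc i = n)}\<rparr>"

lemma pverts_cycle_graph [simp]: "pverts (cycle_graph n) = {..<n}"
  by (simp add: cycle_graph_def)

lemma parcs_cycle_graph:
  "(i, j) \<in> parcs (cycle_graph n) \<longleftrightarrow> i < n \<and> j < n \<and>
     (j = Suc i \<or> i = Suc j \<or> i = 0 \<and> Suc j = n \<or> j = 0 \<and> Suc i = n)"
  by (simp add: cycle_graph_def)

definition cycle_pred :: "nat \<Rightarrow> nat \<Rightarrow> nat" where
  "cycle_pred n i = (if i = 0 then n - 1 else i - 1)"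

definition cycle_succ :: "nat \<Rightarrow> nat \<Rightarrow> nat" where
  "cycle_succ n i = (if Suc i = n then 0 else Suc i)"

lemma neighbors_cycle_graph:
  assumes "i < n"
  shows "neighbors (cycle_graph n) i = {cycle_pred n i, cycle_succ n i}"
  using assms by (auto simp: neighbors_def parcs_cycle_graph cycle_pred_def cycle_succ_def)

lemma cycle_pred_neq_succ:
  assumes "3 \<le> n" "i < n"
  shows "cycle_pred n i \<noteq> cycle_succ n i"
  using assms by (auto simp: cycle_pred_def cycle_succ_def)

text \<open>With \<open>3 \<le> n\<close> the two neighbours are distinct, so the sum over the
  neighbour set has two terms.\<close>

lemma local_rule_cycle_graph:
  assumes "3 \<le> n" "i < n"
  shows "local_rule (cycle_graph n) i x =
    (if x (cycle_pred n i) + x (cycle_succ n i) = 0 then - x i else x i)"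
  using cycle_pred_neq_succ[OF assms] neighbors_cycle_graph[OF assms(2)]
  by (simp add: local_rule_def)

lemma pair_graph_cycle_graph:
  assumes "2 \<le> n"
  shows "pair_graph (cycle_graph n)"
proof
  have "parcs (cycle_graph n) \<subseteq> {..<n} \<times> {..<n}"
    by (auto simp: parcs_cycle_graph)
  then show "finite (parcs (cycle_graph n))"
    by (rule finite_subset) simp
  show "symmetric (with_proj (cycle_graph n))"
    by (auto simp: symmetric_def sym_def parcs_cycle_graph)
qed (use assms in \<open>auto simp: parcs_cycle_graph\<close>)

lemma q2r_network_cycle_graph:
  assumes "2 \<le> p"
  shows "q2r_network (cycle_graph (2 * p)) {i. i < 2 * p \<and> even i} {i. i < 2 * p \<and> odd i}"
proof -
  interpret pair_graph "cycle_graph (2 * p)"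
    using assms by (intro pair_graph_cycle_graph) simp
  show ?thesis
  proof
    fix i j assume "(i, j) \<in> parcs (cycle_graph (2 * p))"
    \<comment> \<open>The wrap-around edge joins 0 to the last vertex, which is odd because the
      cycle has even length.\<close>
    moreover have "odd k" if "Suc k = 2 * p" for k
      using that by presburger
    ultimately show
      "(i \<in> {i. i < 2 * p \<and> even i} \<and> j \<in> {i. i < 2 * p \<and> odd i}) \<or>
       (i \<in> {i. i < 2 * p \<and> odd i} \<and> j \<in> {i. i < 2 * p \<and> even i})"
      by (auto simp: parcs_cycle_graph)
  next
    fix i assume "i \<in> pverts (cycle_graph (2 * p))"
    then show "even (card (neighbors (cycle_graph (2 * p)) i))"
      using assms cycle_pred_neq_succ[of "2 * p" i] by (simp add: neighbors_cycle_graph)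
  qed auto
qed

lemma connected_cycle_graph:
  assumes "2 \<le> n"
  shows "Digraph_Component.connected (with_proj (cycle_graph n))"
proof -
  interpret pair_graph "cycle_graph n"
    using assms by (rule pair_graph_cycle_graph)
  \<comment> \<open>Rising edges lead from 0 to every vertex; reversing such a path by symmetry
    joins any two vertices through 0.\<close>
  have from_0: "0 \<rightarrow>\<^sup>*\<^bsub>cycle_graph n\<^esub> i" if "i < n" for i
    using that
  proof (induction i)
    case 0
    then show ?case by auto
  next
    case (Suc i)
    then have "0 \<rightarrow>\<^sup>*\<^bsub>cycle_graph n\<^esub> i" and "(i, Suc i) \<in> parcs (cycle_graph n)"
      by (simp_all add: parcs_cycle_graph)
    then show ?case
      using reachable_adj_trans by blast
  qed
  have "u \<rightarrow>\<^sup>*\<^bsub>cycle_graph n\<^esub> v" if "u < n" "v < n" for u v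
    using symmetric_reachable[OF sym_arcs from_0[OF that(1)]] from_0[OF that(2)]
    by (rule reachable_trans)
  then show ?thesis
    using assms sym_arcs reachable_mk_symmetric_eq
    by (auto simp: connected_def strongly_connected_def lessThan_empty_iff)
qed

text \<open>For \<open>i > 0\<close>, \<open>i < 2 * t\<close> is the arc 1, ..., 2t - 1 and
  \<open>2 * p < 2 * t + i\<close> is its mirror image. The clause \<open>i = 0\<close> supplies the
  initial -1 at \<open>t = 0\<close>, when both arcs are empty.\<close>

definition wave :: "nat \<Rightarrow> nat \<Rightarrow> nat \<Rightarrow> int" where
  "wave p t i = (if i < 2 * p
     then if i = 0 \<or> (i < 2 * t) \<noteq> (2 * p < 2 * t + i) then -1 else 1
     else undefined)"

text \<open>The intermediate configuration inside one time step, after the update of the even class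
  and before that of the odd class.\<close>

definition half_wave :: "nat \<Rightarrow> nat \<Rightarrow> nat \<Rightarrow> int" where
  "half_wave p t i = (if even i then wave p (Suc t) i else wave p t i)"

lemma wave_even:
  assumes "k < p"
  shows "wave p t (2 * k) = (if k = 0 \<or> (k < t) \<noteq> (p < t + k) then -1 else 1)"
proof -
  have "2 * p < 2 * t + 2 * k \<longleftrightarrow> p < t + k"
    by linarith
  with assms show ?thesis
    by (simp add: wave_def)
qed

text \<open>By parity, 2k + 1 exceeds 2p - 2t as soon as k reaches p - t, hence a weak inequality
  where even vertices have a strict one.\<close>

lemma wave_odd:
  assumes "k < p"
  shows "wave p t (2 * k + 1) = (if (k < t) \<noteq> (p \<le> t + k) then -1 else 1)"
proof -
  have "2 * k + 1 < 2 * p" "2 * k + 1 < 2 * t \<longleftrightarrow> k < t"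
    "2 * p < 2 * t + (2 * k + 1) \<longleftrightarrow> p \<le> t + k"
    using assms by linarith+
  then show ?thesis
    by (simp add: wave_def)
qed

lemma wave_outside: "\<not> i < 2 * p \<Longrightarrow> wave p t i = undefined"
  by (simp add: wave_def)

lemma half_wave_even: "half_wave p t (2 * k) = wave p (Suc t) (2 * k)"
  by (simp add: half_wave_def)

lemma half_wave_odd: "half_wave p t (2 * k + 1) = wave p t (2 * k + 1)"
  by (simp add: half_wave_def)

text \<open>A vertex 2k > 0 joins the first arc in this half-step iff k = t, and the second iff t +
  k = p. These are exactly the cases where its two neighbours differ in membership of that arc; two
  differences cancel, as do two memberships.\<close>

lemma update_even_wave:
  assumes "2 \<le> p" "t < p"
  shows "update_on (cycle_graph (2 * p)) {i. i < 2 * p \<and> even i} (wave p t) = half_wave p t"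
proof
  fix i
  show "update_on (cycle_graph (2 * p)) {i. i < 2 * p \<and> even i} (wave p t) i = half_wave p t i"
  proof (cases "i < 2 * p \<and> even i")
    case True
    then obtain k where k: "i = 2 * k" "k < p" by auto
    define m where "m = (if k = 0 then p - 1 else k - 1)"
    have "m < p"
      using k assms by (auto simp: m_def)
    have "cycle_pred (2 * p) i = 2 * m + 1" "cycle_succ (2 * p) i = 2 * k + 1"
      using k assms unfolding cycle_pred_def cycle_succ_def m_def by presburger+
    then have "update_on (cycle_graph (2 * p)) {i. i < 2 * p \<and> even i} (wave p t) i =
      (if wave p t (2 * m + 1) + wave p t (2 * k + 1) = 0
       then - wave p t (2 * k) else wave p t (2 * k))"
      using k assms local_rule_cycle_graph[of "2 * p" i "wave p t"] by (simp add: update_on_def)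
    also have "\<dots> = wave p (Suc t) (2 * k)"
    proof -
      \<comment> \<open>In the wrap-around case the neighbours 1 and 2p - 1 of vertex 0 are mirror
        images, hence in equal states, and 0 keeps its -1.\<close>
      have "k = 0 \<and> p = Suc m \<or> k = Suc m"
        using k by (auto simp: m_def)
      then show ?thesis
        unfolding wave_even[OF \<open>k < p\<close>] wave_odd[OF \<open>k < p\<close>] wave_odd[OF \<open>m < p\<close>]
        using k assms by auto
    qed
    finally show ?thesis
      unfolding k half_wave_even .
  qed (auto simp: update_on_def half_wave_def wave_outside)
qed

text \<open>The same count, now with k = t and t + k + 1 = p. The fixed -1 at 0 fits it because
  \<open>t < p\<close>: seen from 1, vertex 0 counts as on the first arc only, seen from 2p - 1 as
  on the second only.\<close>

lemma update_odd_half_wave: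
  assumes "2 \<le> p" "t < p"
  shows "update_on (cycle_graph (2 * p)) {i. i < 2 * p \<and> odd i} (half_wave p t) = wave p (Suc t)"
proof
  fix i
  show "update_on (cycle_graph (2 * p)) {i. i < 2 * p \<and> odd i} (half_wave p t) i = wave p (Suc t) i"
  proof (cases "i < 2 * p \<and> odd i")
    case True
    then obtain k where k: "i = 2 * k + 1" "k < p" by (auto elim!: oddE)
    define m where "m = (if Suc k = p then 0 else Suc k)"
    have "m < p"
      using k assms by (auto simp: m_def)
    have "cycle_pred (2 * p) i = 2 * k" "cycle_succ (2 * p) i = 2 * m"
      using k unfolding cycle_pred_def cycle_succ_def m_def by presburger+
    then have "update_on (cycle_graph (2 * p)) {i. i < 2 * p \<and> odd i} (half_wave p t) i =
      (if wave p (Suc t) (2 * k) + wave p (Suc t) (2 * m) = 0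
       then - wave p t (2 * k + 1) else wave p t (2 * k + 1))"
      using k True assms local_rule_cycle_graph[of "2 * p" i "half_wave p t"]
      by (simp only: update_on_def half_wave_even half_wave_odd mem_Collect_eq) simp
    also have "\<dots> = wave p (Suc t) (2 * k + 1)"
      unfolding wave_even[OF \<open>k < p\<close>] wave_odd[OF \<open>k < p\<close>] wave_even[OF \<open>m < p\<close>]
      using k assms by (auto simp: m_def)
    finally show ?thesis
      unfolding k .
  qed (auto simp: update_on_def half_wave_def wave_outside)
qed

lemma q2r_step_wave:
  assumes "2 \<le> p" "t < p"
  shows "q2r_step (cycle_graph (2 * p)) {i. i < 2 * p \<and> even i} {i. i < 2 * p \<and> odd i} (wave p t)
    = wave p (Suc t)"
  using assms by (simp add: q2r_step_def update_even_wave update_odd_half_wave)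

lemma funpow_q2r_step_wave:
  assumes "2 \<le> p" "t \<le> p"
  shows "(q2r_step (cycle_graph (2 * p)) {i. i < 2 * p \<and> even i} {i. i < 2 * p \<and> odd i} ^^ t)
    (wave p 0) = wave p t"
  using assms(2) by (induction t) (simp_all add: q2r_step_wave[OF assms(1)])

lemma has_limit_cycle_cycle_graph:
  assumes "2 \<le> p"
  shows "has_limit_cycle (cycle_graph (2 * p)) {i. i < 2 * p \<and> even i} {i. i < 2 * p \<and> odd i} p"
  unfolding has_limit_cycle_def
proof (intro conjI bexI[of _ "wave p 0"] allI impI)
  show "1 \<le> p"
    using assms by simp
  show "wave p 0 \<in> configurations (cycle_graph (2 * p))"
    by (auto simp: configurations_def wave_def PiE_iff extensional_def)
  have "wave p p = wave p 0"
    by (auto simp: wave_def)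
  then show "(q2r_step (cycle_graph (2 * p)) {i. i < 2 * p \<and> even i} {i. i < 2 * p \<and> odd i} ^^ p)
    (wave p 0) = wave p 0"
    using assms by (simp add: funpow_q2r_step_wave)
  fix s assume s: "1 \<le> s \<and> s < p"
  \<comment> \<open>Vertex 1 is on the first arc as \<open>1 < 2 * s\<close>, but off the second as
    \<open>2 * s + 1 < 2 * p\<close>.\<close>
  then have "wave p s 1 \<noteq> wave p 0 1"
    by (auto simp: wave_def)
  then show "(q2r_step (cycle_graph (2 * p)) {i. i < 2 * p \<and> even i} {i. i < 2 * p \<and> odd i} ^^ s)
    (wave p 0) \<noteq> wave p 0"
    using assms s by (auto simp: funpow_q2r_step_wave)
qed

theorem proposition1:
  fixes p :: nat
  assumes "prime p"
  shows "\<exists>(G :: nat pair_pre_digraph) A B.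
    q2r_network G A B \<and> Digraph_Component.connected (with_proj G) \<and>
    card (pverts G) = 2 * p \<and> has_limit_cycle G A B p"
proof -
  have "2 \<le> p"
    using assms by (rule prime_ge_2_nat)
  then show ?thesis
    using q2r_network_cycle_graph connected_cycle_graph[of "2 * p"] has_limit_cycle_cycle_graph
    by (intro exI[of _ "cycle_graph (2 * p)"] exI conjI) auto
qed

end
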